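(* \[1+\sum_{n\ge1}|\mathrm{SAv}_n(321,3412)|x^n=\frac{1}{1-x-x^2-2x^3}.\]
   Context: Permutations $\pi\in S_n$ are identified with words $\pi(1)\cdots\pi(n)$. For $\tau\in S_m$, entries $\pi(i_1),\ldots,\pi(i_m)$ with $i_1<\cdots<i_m$ form an occurrence of $\tau$ if for all $j,l$, $\pi(i_j)<\pi(i_l)$ iff $\tau(j)<\tau(l)$; $\pi$ avoids $\tau$ if there is no occurrence. $\mathrm{SAv}_n(\tau_1,\ldots,\tau_r)$ is the set of $\pi\in S_n$ such that both $\pi$ and $\pi^2=\pi\circ\pi$ avoid each of $\tau_1,\ldots,\tau_r$. *)

theory Defs
  imports
    "HOL-Combinatorics.Permutations"
    "HOL-Computational_Algebra.Formal_Power_Series"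
begin

text \<open>
  An element of \<open>S\<^sub>n\<close> is a function \<open>\<pi>\<close> with \<open>\<pi> permutes {1..n}\<close>. A pattern \<open>\<tau> \<in> S\<^sub>m\<close> is given as
  the word \<open>\<tau>(1)\<dots>\<tau>(m)\<close>, a list of length \<open>m\<close>; positions in the pattern are therefore counted
  from 0, so that \<open>\<tau> ! j\<close> is \<open>\<tau>(j+1)\<close> and \<open>i j\<close> is the index \<open>i\<close> with subscript \<open>j+1\<close>.
\<close>

definition occurrence :: "nat \<Rightarrow> (nat \<Rightarrow> nat) \<Rightarrow> nat list \<Rightarrow> (nat \<Rightarrow> nat) \<Rightarrow> bool" where
  "occurrence n \<pi> \<tau> i \<longleftrightarrow>
     strict_mono_on {..<length \<tau>} i \<and> i ` {..<length \<tau>} \<subseteq> {1..n} \<and>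
     (\<forall>j<length \<tau>. \<forall>l<length \<tau>. \<pi> (i j) < \<pi> (i l) \<longleftrightarrow> \<tau> ! j < \<tau> ! l)"

definition avoids :: "nat \<Rightarrow> (nat \<Rightarrow> nat) \<Rightarrow> nat list \<Rightarrow> bool" where
  "avoids n \<pi> \<tau> \<longleftrightarrow> \<not> (\<exists>i. occurrence n \<pi> \<tau> i)"

definition SAv :: "nat \<Rightarrow> nat list set \<Rightarrow> (nat \<Rightarrow> nat) set" where
  "SAv n T = {\<pi>. \<pi> permutes {1..n} \<and> (\<forall>\<tau>\<in>T. avoids n \<pi> \<tau> \<and> avoids n (\<pi> \<circ> \<pi>) \<tau>)}"

end

theory Submission
  imports Defs
begin

text \<open>
  Both patterns are indecomposable, so avoidance by \<open>\<pi>\<close> and by \<open>\<pi>\<^sup>2\<close> can be tested on the blocks of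
  a direct sum. If \<open>\<pi>\<close> avoids 321 and 3412, then \<open>\<pi>(1) \<le> 2\<close> or \<open>\<pi>(2) = 1\<close>; the two cases are exchanged by
  inversion, under which both patterns are invariant. Looking for the patterns
  in \<open>\<pi>\<^sup>2\<close> as well leaves only 1, 21, 231 and 312 as possible first blocks, whence
  \<open>a\<^sub>n = a\<^sub>n\<^sub>-\<^sub>1 + a\<^sub>n\<^sub>-\<^sub>2 + 2 a\<^sub>n\<^sub>-\<^sub>3\<close>.
\<close>

section \<open>Avoidance of both patterns as inequalities between entries\<close>

text \<open>Positions increase along the quantifiers, while each forbidden chain lists them by
  increasing value. Such a strict chain determines every comparison that \<open>occurrence\<close>
  asks for.\<close>

definition avoids_both :: "nat \<Rightarrow> (nat \<Rightarrow> nat) \<Rightarrow> bool" where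
  "avoids_both n \<pi> \<longleftrightarrow>
     (\<forall>i j k. 1 \<le> i \<and> i < j \<and> j < k \<and> k \<le> n \<longrightarrow> \<not> (\<pi> k < \<pi> j \<and> \<pi> j < \<pi> i)) \<and>
     (\<forall>i j k l. 1 \<le> i \<and> i < j \<and> j < k \<and> k < l \<and> l \<le> n \<longrightarrow>
        \<not> (\<pi> k < \<pi> l \<and> \<pi> l < \<pi> i \<and> \<pi> i < \<pi> j))"

lemma avoids_both_321D:
  "avoids_both n \<pi> \<Longrightarrow> 1 \<le> i \<Longrightarrow> i < j \<Longrightarrow> j < k \<Longrightarrow> k \<le> n \<Longrightarrow> \<pi> k < \<pi> j \<Longrightarrow> \<pi> j < \<pi> i \<Longrightarrow> False"
  unfolding avoids_both_def by blast

lemma avoids_both_3412D: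
  "avoids_both n \<pi> \<Longrightarrow> 1 \<le> i \<Longrightarrow> i < j \<Longrightarrow> j < k \<Longrightarrow> k < l \<Longrightarrow> l \<le> n \<Longrightarrow>
     \<pi> k < \<pi> l \<Longrightarrow> \<pi> l < \<pi> i \<Longrightarrow> \<pi> i < \<pi> j \<Longrightarrow> False"
  unfolding avoids_both_def by blast

lemma avoids_321_iff:
  "avoids n \<pi> [3,2,1] \<longleftrightarrow>
     (\<forall>i j k. 1 \<le> i \<and> i < j \<and> j < k \<and> k \<le> n \<longrightarrow> \<not> (\<pi> k < \<pi> j \<and> \<pi> j < \<pi> i))"
proof -
  have "(\<exists>f. occurrence n \<pi> [3,2,1] f) \<longleftrightarrow>
    (\<exists>i j k. 1 \<le> i \<and> i < j \<and> j < k \<and> k \<le> n \<and> \<pi> k < \<pi> j \<and> \<pi> j < \<pi> i)" (is "?L \<longleftrightarrow> ?R")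
  proof
    assume ?L
    then obtain f where f: "occurrence n \<pi> [3,2,1] f" by blast
    then have "1 \<le> f 0 \<and> f 0 < f 1 \<and> f 1 < f 2 \<and> f 2 \<le> n \<and> \<pi> (f 2) < \<pi> (f 1) \<and> \<pi> (f 1) < \<pi> (f 0)"
      by (auto simp: occurrence_def strict_mono_on_def image_subset_iff
          lessThan_Suc numeral_2_eq_2 All_less_Suc)
    then show ?R by blast
  next
    assume ?R
    then obtain i j k where h: "1 \<le> i" "i < j" "j < k" "k \<le> n" "\<pi> k < \<pi> j" "\<pi> j < \<pi> i" by blast
    \<comment> \<open>Only indices below the length of the pattern are inspected, so the list of
      positions itself serves as the index function.\<close>
    have "occurrence n \<pi> [3,2,1] (\<lambda>x. [i,j,k] ! x)"
      using h by (auto simp: occurrence_def strict_mono_on_def image_subset_iff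
          lessThan_Suc numeral_2_eq_2 All_less_Suc)
    then show ?L by blast
  qed
  then show ?thesis by (auto simp: avoids_def)
qed

lemma avoids_3412_iff:
  "avoids n \<pi> [3,4,1,2] \<longleftrightarrow>
     (\<forall>i j k l. 1 \<le> i \<and> i < j \<and> j < k \<and> k < l \<and> l \<le> n \<longrightarrow>
        \<not> (\<pi> k < \<pi> l \<and> \<pi> l < \<pi> i \<and> \<pi> i < \<pi> j))"
proof -
  have "(\<exists>f. occurrence n \<pi> [3,4,1,2] f) \<longleftrightarrow>
    (\<exists>i j k l. 1 \<le> i \<and> i < j \<and> j < k \<and> k < l \<and> l \<le> n \<and> \<pi> k < \<pi> l \<and> \<pi> l < \<pi> i \<and> \<pi> i < \<pi> j)"
    (is "?L \<longleftrightarrow> ?R")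
  proof
    assume ?L
    then obtain f where f: "occurrence n \<pi> [3,4,1,2] f" by blast
    then have "1 \<le> f 0 \<and> f 0 < f 1 \<and> f 1 < f 2 \<and> f 2 < f 3 \<and> f 3 \<le> n \<and>
        \<pi> (f 2) < \<pi> (f 3) \<and> \<pi> (f 3) < \<pi> (f 0) \<and> \<pi> (f 0) < \<pi> (f 1)"
      by (auto simp: occurrence_def strict_mono_on_def image_subset_iff
          lessThan_Suc numeral_2_eq_2 numeral_3_eq_3 All_less_Suc)
    then show ?R by blast
  next
    assume ?R
    then obtain i j k l where h: "1 \<le> i" "i < j" "j < k" "k < l" "l \<le> n"
      "\<pi> k < \<pi> l" "\<pi> l < \<pi> i" "\<pi> i < \<pi> j" by blast
    have "occurrence n \<pi> [3,4,1,2] (\<lambda>x. [i,j,k,l] ! x)"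
      using h by (auto simp: occurrence_def strict_mono_on_def image_subset_iff
          lessThan_Suc numeral_2_eq_2 numeral_3_eq_3 All_less_Suc)
    then show ?L by blast
  qed
  then show ?thesis by (auto simp: avoids_def)
qed

(* Otherwise the entries 1 of the patterns become Suc 0, and the rules about SAv no longer match. *)
declare One_nat_def [simp del]

lemma mem_SAv_iff:
  "\<pi> \<in> SAv n {[3,2,1], [3,4,1,2]} \<longleftrightarrow>
     \<pi> permutes {1..n} \<and> avoids_both n \<pi> \<and> avoids_both n (\<pi> \<circ> \<pi>)"
  unfolding SAv_def avoids_both_def
  by (auto simp only: avoids_321_iff avoids_3412_iff ball_simps mem_Collect_eq)

section \<open>Symmetry under inversion\<close>

text \<open>Inversion exchanges positions and values, and both patterns are involutions. The values
  of an occurrence in \<open>inv \<pi>\<close>, sorted increasingly, are therefore the positions of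
  an occurrence of the same pattern in \<pi>.\<close>

lemma avoids_both_inv:
  assumes p: "\<pi> permutes {1..n}" and av: "avoids_both n \<pi>"
  shows "avoids_both n (inv \<pi>)"
proof -
  have [simp]: "\<pi> (inv \<pi> x) = x" for x
    using permutes_inverses(1)[OF p] .
  have b: "inv \<pi> x \<in> {1..n} \<longleftrightarrow> x \<in> {1..n}" for x
    using permutes_in_image[OF permutes_inv[OF p]] .
  show ?thesis
    unfolding avoids_both_def
  proof (intro conjI allI impI notI)
    fix i j k
    assume h: "1 \<le> i \<and> i < j \<and> j < k \<and> k \<le> n" "inv \<pi> k < inv \<pi> j \<and> inv \<pi> j < inv \<pi> i"
    then show False
      using avoids_both_321D[OF av, of "inv \<pi> k" "inv \<pi> j" "inv \<pi> i"] b[of i] b[of k] by auto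
  next
    fix i j k l
    assume h: "1 \<le> i \<and> i < j \<and> j < k \<and> k < l \<and> l \<le> n"
      "inv \<pi> k < inv \<pi> l \<and> inv \<pi> l < inv \<pi> i \<and> inv \<pi> i < inv \<pi> j"
    then show False
      using avoids_both_3412D[OF av, of "inv \<pi> k" "inv \<pi> l" "inv \<pi> i" "inv \<pi> j"]
        b[of j] b[of k] by auto
  qed
qed

lemma inv_mem_SAv:
  assumes "\<pi> \<in> SAv n {[3,2,1], [3,4,1,2]}"
  shows "inv \<pi> \<in> SAv n {[3,2,1], [3,4,1,2]}"
proof -
  from assms have p: "\<pi> permutes {1..n}" and a: "avoids_both n \<pi>" "avoids_both n (\<pi> \<circ> \<pi>)"
    by (simp_all add: mem_SAv_iff)
  have "inv (\<pi> \<circ> \<pi>) = inv \<pi> \<circ> inv \<pi>"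
    using permutes_bij[OF p] by (simp add: o_inv_distrib)
  then show ?thesis
    using avoids_both_inv[OF p a(1)] avoids_both_inv[OF permutes_compose[OF p p] a(2)]
      permutes_inv[OF p] by (simp add: mem_SAv_iff)
qed

section \<open>Classification of the first block\<close>

text \<open>Otherwise the value 1 comes after position 2, at \<open>m\<close>. Avoiding 321 puts the
  value 2 at a later position \<open>q\<close>. A descent at the first two positions gives 321 with
  \<open>m\<close>; an ascent gives 3412 with \<open>m\<close> and \<open>q\<close>.\<close>

lemma first_le_2_or_second_eq_1:
  assumes p: "\<pi> permutes {1..n}" and n: "1 \<le> n" and av: "avoids_both n \<pi>"
  shows "\<pi> 1 = 1 \<or> \<pi> 1 = 2 \<or> \<pi> 2 = 1"
proof (rule ccontr)
  assume neg: "\<not> ?thesis"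
  have inj: "\<pi> x = \<pi> y \<longleftrightarrow> x = y" for x y
    using permutes_inj[OF p] by (auto dest: injD)
  have im: "\<pi> x \<in> {1..n} \<longleftrightarrow> x \<in> {1..n}" for x
    using permutes_in_image[OF p] .
  have k: "\<pi> 1 \<ge> 3" using neg im[of 1] n by auto
  obtain m where m: "\<pi> m = 1" using permutes_surj[OF p] by (metis surjD)
  obtain q where q: "\<pi> q = 2" using permutes_surj[OF p] by (metis surjD)
  have mb: "3 \<le> m" "m \<le> n" using im[of m] m n neg by (cases "m = 1"; cases "m = 2"; auto)+
  have "\<pi> 1 \<le> n" using im[of 1] n by auto
  then have qb: "1 \<le> q" "q \<le> n" using im[of q] q k by auto
  have "q \<noteq> 1" "q \<noteq> m" using q k m by auto
  with qb avoids_both_321D[OF av, of 1 q m] have "m < q" using k q m mb by force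
  have ne: "\<pi> 2 \<noteq> \<pi> 1" "\<pi> 2 \<noteq> 1" "\<pi> 2 \<noteq> 0" using inj[of 2 1] inj[of 2 m] im[of 2] m mb by auto
  show False
  proof (cases "\<pi> 2 < \<pi> 1")
    case True
    then show False using avoids_both_321D[OF av, of 1 2 m] m mb ne by force
  next
    case False
    then show False using avoids_both_3412D[OF av, of 1 2 m q] m mb q qb \<open>m < q\<close> ne k by force
  qed
qed

text \<open>The argument follows 1 backwards under \<pi>: \<open>m\<close> is its preimage and
  \<open>x\<close> the preimage of \<open>m\<close>. The case \<open>x \<noteq> 2\<close> is refuted
  by \<open>\<pi> \<circ> \<pi>\<close>, the case \<open>x = 2\<close> by \<pi> itself.\<close>

lemma first_eq_2_block:
  assumes p: "\<pi> permutes {1..n}" and av: "avoids_both n \<pi>" and av2: "avoids_both n (\<pi> \<circ> \<pi>)"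
    and n: "1 \<le> n" and k: "\<pi> 1 = 2"
  shows "\<pi> 2 = 1 \<or> \<pi> 2 = 3 \<and> \<pi> 3 = 1"
proof (rule ccontr)
  assume neg: "\<not> ?thesis"
  have inj: "\<pi> x = \<pi> y \<longleftrightarrow> x = y" for x y
    using permutes_inj[OF p] by (auto dest: injD)
  have im: "\<pi> x \<in> {1..n} \<longleftrightarrow> x \<in> {1..n}" for x
    using permutes_in_image[OF p] .
  have n2: "2 \<le> n" using im[of 1] n k by auto
  define j where "j = \<pi> 2"
  have j: "j \<ge> 3" "j \<le> n" using im[of 2] n2 neg inj[of 1 2] k by (auto simp: j_def)
  obtain m where m: "\<pi> m = 1" using permutes_surj[OF p] by (metis surjD)
  obtain x where x: "\<pi> x = m" using permutes_surj[OF p] by (metis surjD)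
  have mb: "3 \<le> m" "m \<le> n" using im[of m] m n neg k by (cases "m = 1"; cases "m = 2"; auto)+
  have xb: "1 \<le> x" "x \<le> n" using im[of x] x mb by auto
  have x1: "x \<noteq> 1" using x k mb by auto
  have xm: "x \<noteq> m" using x m mb by auto
  have sq: "(\<pi> \<circ> \<pi>) 1 = j" "(\<pi> \<circ> \<pi>) m = 2" "(\<pi> \<circ> \<pi>) x = 1"
    using k m x by (auto simp: j_def)
  \<comment> \<open>Otherwise \<open>\<pi> \<circ> \<pi>\<close> has the values \<open>j\<close>, 2,
    1 at the positions \<open>1 < m < x\<close>, which is 321.\<close>
  have xlt: "x < m"
    using avoids_both_321D[OF av2, of 1 m x] sq j mb xb xm by force
  show False
  proof (cases "x = 2")
    case False
    have "\<pi> j \<noteq> 1" "\<pi> j \<noteq> 2" "\<pi> j \<noteq> j" "\<pi> j \<noteq> 0"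
      using inj[of j m] inj[of j 1] inj[of j 2] inj[of 2 x] im[of j] m k j False x
      by (auto simp: j_def)
    moreover have "(\<pi> \<circ> \<pi>) 2 = \<pi> j" by (simp add: j_def)
    \<comment> \<open>At the positions \<open>1 < 2 < x < m\<close> the square has the values
      \<open>j\<close>, \<open>\<pi> j\<close>, 1, 2. It contains 321 if \<open>\<pi> j < j\<close>,
      and 3412 otherwise.\<close>
    ultimately show False
      using avoids_both_321D[OF av2, of 1 2 x] avoids_both_3412D[OF av2, of 1 2 x m]
        sq False x1 xb xlt mb j by force
  next
    case True
    then have jm: "j = m" using x j_def by simp
    then have "m \<noteq> 3" using neg m by (auto simp: j_def)
    then have m4: "m \<ge> 4" using mb by simp
    have "\<pi> 3 \<noteq> m" "\<pi> 3 \<noteq> 1" "\<pi> 3 \<noteq> 0"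
      using inj[of 3 2] inj[of 3 m] im[of 3] m m4 mb x True by auto
    moreover have "\<not> \<pi> 3 < m"
      using avoids_both_321D[OF av, of 2 3 m] m m4 mb x True calculation by force
    ultimately have p3: "\<pi> 3 > m" by simp
    \<comment> \<open>The value 3 completes a 3412: once \<open>q\<close> lies beyond
      \<open>m\<close>, the positions 2, 3, \<open>m\<close>, \<open>q\<close> carry
      \<open>m\<close>, \<open>\<pi> 3\<close>, 1, 3.\<close>
    obtain q where q: "\<pi> q = 3" using permutes_surj[OF p] by (metis surjD)
    have qb: "q \<noteq> 1" "q \<noteq> 2" "q \<noteq> m" "q \<noteq> 3" "1 \<le> q" "q \<le> n"
      using q k x True m m4 p3 im[of q] mb by auto
    then have "m < q"
      using avoids_both_321D[OF av, of 2 q m] q m m4 mb x True by force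
    then show False
      using avoids_both_3412D[OF av, of 2 3 m q] p3 q m m4 x True qb by force
  qed
qed

lemma first_block_cases:
  assumes S: "\<pi> \<in> SAv n {[3,2,1], [3,4,1,2]}" and n: "1 \<le> n"
  shows "\<pi> 1 = 1 \<or> \<pi> 1 = 2 \<and> \<pi> 2 = 1 \<or> \<pi> 1 = 2 \<and> \<pi> 2 = 3 \<and> \<pi> 3 = 1
    \<or> \<pi> 1 = 3 \<and> \<pi> 2 = 1 \<and> \<pi> 3 = 2"
proof -
  have p: "\<pi> permutes {1..n}" and a: "avoids_both n \<pi>" "avoids_both n (\<pi> \<circ> \<pi>)"
    using S by (simp_all add: mem_SAv_iff)
  have p': "inv \<pi> permutes {1..n}" and a': "avoids_both n (inv \<pi>)" "avoids_both n (inv \<pi> \<circ> inv \<pi>)"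
    using inv_mem_SAv[OF S] by (simp_all add: mem_SAv_iff)
  have iff: "inv \<pi> x = y \<longleftrightarrow> \<pi> y = x" for x y
    using permutes_inv_eq[OF p] by blast
  from first_le_2_or_second_eq_1[OF p n a(1)] consider "\<pi> 1 = 1" | "\<pi> 1 = 2" | "\<pi> 2 = 1" by blast
  then show ?thesis
  proof cases
    case 2
    then show ?thesis using first_eq_2_block[OF p a n] by blast
  next
    case 3
    \<comment> \<open>The previous lemma applied to the inverse yields the blocks 21 and 231 there,
      hence 21 and 312 for \<pi>.\<close>
    then have "inv \<pi> 1 = 2" by (simp add: iff)
    then show ?thesis using first_eq_2_block[OF p' a' n] 3 by (auto simp: iff)
  qed simp
qed

section \<open>Direct sums of permutations\<close>

text \<open>If \<sigma> and \<rho> permute \<open>{1..b}\<close> and \<open>{1..n}\<close>, the two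
  branches also fix 0 and everything above \<open>n + b\<close>, as \<open>permutes\<close>
  demands.\<close>

definition direct_sum :: "nat \<Rightarrow> (nat \<Rightarrow> nat) \<Rightarrow> (nat \<Rightarrow> nat) \<Rightarrow> nat \<Rightarrow> nat" where
  "direct_sum b \<sigma> \<rho> = (\<lambda>i. if i \<le> b then \<sigma> i else \<rho> (i - b) + b)"

lemma permutes_le_iff:
  assumes "\<sigma> permutes {1..b :: nat}"
  shows "\<sigma> i \<le> b \<longleftrightarrow> i \<le> b" and "\<sigma> i = 0 \<longleftrightarrow> i = 0"
proof -
  have "\<sigma> 0 = 0" "\<And>i. b < i \<Longrightarrow> \<sigma> i = i" using permutes_not_in[OF assms] by auto
  moreover have "\<sigma> i \<in> {1..b} \<longleftrightarrow> i \<in> {1..b}" using permutes_in_image[OF assms] .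
  ultimately show "\<sigma> i \<le> b \<longleftrightarrow> i \<le> b" and "\<sigma> i = 0 \<longleftrightarrow> i = 0"
    by (cases "i = 0"; cases "i \<le> b"; force)+
qed

lemma direct_sum_le_iff:
  assumes "\<sigma> permutes {1..b}" "\<rho> permutes {1..n}"
  shows "direct_sum b \<sigma> \<rho> i \<le> b \<longleftrightarrow> i \<le> b"
  using permutes_le_iff[OF assms(1)] permutes_le_iff(2)[OF assms(2), of "i - b"]
  by (auto simp: direct_sum_def)

text \<open>Each summand preserves its own block, so squaring acts blockwise; this transfers the
  condition on the square to the summands.\<close>

lemma direct_sum_comp:
  assumes "\<sigma> permutes {1..b}" "\<rho> permutes {1..n}"
  shows "direct_sum b \<sigma> \<rho> \<circ> direct_sum b \<sigma> \<rho> = direct_sum b (\<sigma> \<circ> \<sigma>) (\<rho> \<circ> \<rho>)"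
  using permutes_le_iff[OF assms(1)] permutes_le_iff(2)[OF assms(2)]
  by (auto simp: direct_sum_def fun_eq_iff)

lemma direct_sum_permutes:
  assumes s: "\<sigma> permutes {1..b}" and r: "\<rho> permutes {1..n}"
  shows "direct_sum b \<sigma> \<rho> permutes {1..n + b}"
proof (rule inj_imp_permutes)
  show "inj_on (direct_sum b \<sigma> \<rho>) {1..n + b}"
  proof (rule inj_onI)
    fix x y
    assume "direct_sum b \<sigma> \<rho> x = direct_sum b \<sigma> \<rho> y"
    moreover from this have "x \<le> b \<longleftrightarrow> y \<le> b"
      using direct_sum_le_iff[OF s r] by metis
    ultimately show "x = y"
      using injD[OF permutes_inj[OF s], of x y] injD[OF permutes_inj[OF r], of "x - b" "y - b"]
      by (auto simp: direct_sum_def split: if_splits)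
  qed
  show "direct_sum b \<sigma> \<rho> x \<in> {1..n + b}" if "x \<in> {1..n + b}" for x
    using that permutes_in_image[OF s, of x] permutes_in_image[OF r, of "x - b"]
    by (auto simp: direct_sum_def)
  show "direct_sum b \<sigma> \<rho> x = x" if "x \<notin> {1..n + b}" for x
  proof -
    have "x \<notin> {1..b}" "x - b \<notin> {1..n}" using that by auto
    then show ?thesis
      using that permutes_not_in[OF s, of x] permutes_not_in[OF r, of "x - b"]
      by (auto simp: direct_sum_def)
  qed
qed simp

text \<open>In both patterns the last entry is smaller than the first. An occurrence that starts in
  the lower block thus also ends there, and any other lies wholly in the upper block.\<close>

lemma avoids_both_direct_sum_iff:
  assumes s: "\<sigma> permutes {1..b}" and r: "\<rho> permutes {1..n}" and av: "avoids_both b \<sigma>"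
  shows "avoids_both (n + b) (direct_sum b \<sigma> \<rho>) \<longleftrightarrow> avoids_both n \<rho>"
proof
  let ?f = "direct_sum b \<sigma> \<rho>"
  have f: "?f (i + b) = \<rho> i + b" if "i \<ge> 1" for i
    using that by (simp add: direct_sum_def)
  assume a: "avoids_both (n + b) ?f"
  show "avoids_both n \<rho>"
    unfolding avoids_both_def
  proof (intro conjI allI impI notI)
    fix i j k
    assume "1 \<le> i \<and> i < j \<and> j < k \<and> k \<le> n" "\<rho> k < \<rho> j \<and> \<rho> j < \<rho> i"
    then show False
      using avoids_both_321D[OF a, of "i + b" "j + b" "k + b"] by (simp add: f)
  next
    fix i j k l
    assume "1 \<le> i \<and> i < j \<and> j < k \<and> k < l \<and> l \<le> n" "\<rho> k < \<rho> l \<and> \<rho> l < \<rho> i \<and> \<rho> i < \<rho> j"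
    then show False
      using avoids_both_3412D[OF a, of "i + b" "j + b" "k + b" "l + b"] by (simp add: f)
  qed
next
  let ?f = "direct_sum b \<sigma> \<rho>"
  assume a: "avoids_both n \<rho>"
  have le: "?f i \<le> b \<longleftrightarrow> i \<le> b" for i using direct_sum_le_iff[OF s r] .
  have lo: "?f i = \<sigma> i" if "i \<le> b" for i using that by (simp add: direct_sum_def)
  have hi: "?f i = \<rho> (i - b) + b" if "b < i" for i using that by (simp add: direct_sum_def)
  show "avoids_both (n + b) ?f"
    unfolding avoids_both_def
  proof (intro conjI allI impI notI)
    fix i j k
    assume h: "1 \<le> i \<and> i < j \<and> j < k \<and> k \<le> n + b" "?f k < ?f j \<and> ?f j < ?f i"
    show False
    proof (cases "i \<le> b")
      case True
      then have "k \<le> b" using h le[of i] le[of k] by linarith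
      then show False using avoids_both_321D[OF av, of i j k] h by (simp add: lo)
    next
      case False
      then have "1 \<le> i - b" "i - b < j - b" "j - b < k - b" "k - b \<le> n" using h by auto
      then show False
        using avoids_both_321D[OF a, of "i - b" "j - b" "k - b"] h False by (simp add: hi)
    qed
  next
    fix i j k l
    assume h: "1 \<le> i \<and> i < j \<and> j < k \<and> k < l \<and> l \<le> n + b"
      "?f k < ?f l \<and> ?f l < ?f i \<and> ?f i < ?f j"
    show False
    proof (cases "i \<le> b")
      case True
      then have "l \<le> b" using h le[of i] le[of l] by linarith
      then show False using avoids_both_3412D[OF av, of i j k l] h by (simp add: lo)
    next
      case False
      then have "1 \<le> i - b" "i - b < j - b" "j - b < k - b" "k - b < l - b" "l - b \<le> n"
        using h by auto
      then show False
        using avoids_both_3412D[OF a, of "i - b" "j - b" "k - b" "l - b"] h False by (simp add: hi)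
    qed
  qed
qed

text \<open>The values up to \<open>b\<close> are used up by \<sigma>, so by injectivity the later
  positions take values above \<open>b\<close>; shifting them down gives \<rho>.\<close>

lemma permutes_eq_direct_sum:
  assumes s: "\<sigma> permutes {1..b}" and p: "\<pi> permutes {1..n + b}"
    and eq: "\<And>i. i \<in> {1..b} \<Longrightarrow> \<pi> i = \<sigma> i"
  obtains \<rho> where "\<rho> permutes {1..n}" "\<pi> = direct_sum b \<sigma> \<rho>"
proof
  define \<rho> where "\<rho> = (\<lambda>i. if i = 0 then 0 else \<pi> (i + b) - b)"
  have eq': "\<pi> i = \<sigma> i" if "i \<le> b" for i
    using that eq permutes_not_in[OF s, of 0] permutes_not_in[OF p, of 0] by (cases "i = 0") auto
  have gt: "b < \<pi> i" if "b < i" for i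
  proof (rule ccontr)
    assume neg: "\<not> b < \<pi> i"
    obtain y where y: "\<sigma> y = \<pi> i" using permutes_surj[OF s] by (metis surjD)
    then have "y \<le> b" using neg permutes_le_iff(1)[OF s, of y] by simp
    then have "\<pi> y = \<pi> i" using eq' y by simp
    then show False using injD[OF permutes_inj[OF p]] \<open>y \<le> b\<close> that by fastforce
  qed
  show "\<pi> = direct_sum b \<sigma> \<rho>"
  proof
    show "\<pi> i = direct_sum b \<sigma> \<rho> i" for i
      using eq'[of i] gt[of i] by (auto simp: direct_sum_def \<rho>_def)
  qed
  show "\<rho> permutes {1..n}"
  proof (rule inj_imp_permutes)
    show "inj_on \<rho> {1..n}"
    proof (rule inj_onI)
      fix x y
      assume "x \<in> {1..n}" "y \<in> {1..n}" "\<rho> x = \<rho> y"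
      then have "\<pi> (x + b) = \<pi> (y + b)"
        using gt[of "x + b"] gt[of "y + b"] by (simp add: \<rho>_def)
      then show "x = y" using injD[OF permutes_inj[OF p]] by fastforce
    qed
    show "\<rho> x \<in> {1..n}" if "x \<in> {1..n}" for x
      using that gt[of "x + b"] permutes_in_image[OF p, of "x + b"] by (auto simp: \<rho>_def)
    show "\<rho> x = x" if "x \<notin> {1..n}" for x
      using that permutes_not_in[OF p, of "x + b"] by (auto simp: \<rho>_def)
  qed simp
qed

section \<open>Counting by first block\<close>

text \<open>Prefixing \<sigma> is a bijection from the permutations counted on the right to those
  counted on the left.\<close>

lemma card_SAv_first_block:
  assumes S: "\<sigma> \<in> SAv b {[3,2,1], [3,4,1,2]}"
  shows "card {\<pi> \<in> SAv (n + b) {[3,2,1], [3,4,1,2]}. \<forall>i\<in>{1..b}. \<pi> i = \<sigma> i}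
    = card (SAv n {[3,2,1], [3,4,1,2]})"
proof -
  let ?S = "\<lambda>n. SAv n {[3,2,1], [3,4,1,2]}"
  from S have s: "\<sigma> permutes {1..b}" and a: "avoids_both b \<sigma>" "avoids_both b (\<sigma> \<circ> \<sigma>)"
    by (simp_all add: mem_SAv_iff)
  have mem: "direct_sum b \<sigma> \<rho> \<in> ?S (n + b) \<longleftrightarrow> \<rho> \<in> ?S n" if r: "\<rho> permutes {1..n}" for \<rho>
    using avoids_both_direct_sum_iff[OF s r a(1)] direct_sum_permutes[OF s r] r
      avoids_both_direct_sum_iff[OF permutes_compose[OF s s] permutes_compose[OF r r] a(2)]
    by (simp add: mem_SAv_iff direct_sum_comp[OF s r])
  have inj: "inj_on (direct_sum b \<sigma>) (?S n)"
  proof (rule inj_onI)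
    fix \<rho> \<rho>'
    assume h: "\<rho> \<in> ?S n" "\<rho>' \<in> ?S n" and e: "direct_sum b \<sigma> \<rho> = direct_sum b \<sigma> \<rho>'"
    show "\<rho> = \<rho>'"
    proof
      fix i
      \<comment> \<open>Position \<open>i + b\<close> reveals \<rho> only for
        \<open>i \<ge> 1\<close>; at 0 both permutations have the value 0.\<close>
      show "\<rho> i = \<rho>' i"
        using h permutes_le_iff(2)[of \<rho> n i] permutes_le_iff(2)[of \<rho>' n i] fun_cong[OF e, of "i + b"]
        by (cases "i = 0") (simp_all add: mem_SAv_iff direct_sum_def)
    qed
  qed
  have image: "direct_sum b \<sigma> ` ?S n = {\<pi> \<in> ?S (n + b). \<forall>i\<in>{1..b}. \<pi> i = \<sigma> i}" (is "?L = ?R")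
  proof (intro equalityI subsetI)
    fix \<pi> assume "\<pi> \<in> ?L"
    then obtain \<rho> where "\<rho> \<in> ?S n" "\<pi> = direct_sum b \<sigma> \<rho>" by blast
    moreover from this have "\<pi> \<in> ?S (n + b)" using mem by (simp add: mem_SAv_iff)
    ultimately show "\<pi> \<in> ?R" by (simp add: direct_sum_def)
  next
    fix \<pi> assume h: "\<pi> \<in> ?R"
    then have "\<pi> permutes {1..n + b}" by (simp add: mem_SAv_iff)
    then obtain \<rho> where "\<rho> permutes {1..n}" "\<pi> = direct_sum b \<sigma> \<rho>"
      using permutes_eq_direct_sum[OF s] h by blast
    then show "\<pi> \<in> ?L" using h mem by blast
  qed
  show ?thesis using card_image[OF inj] unfolding image .
qed

text \<open>With at most three positions there is no room for 3412, and the only candidate for 321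
  is the triple 1, 2, 3.\<close>

lemma mem_SAv_small:
  assumes "\<sigma> permutes {1..b}" "b \<le> 3" "\<not> (\<sigma> 3 < \<sigma> 2 \<and> \<sigma> 2 < \<sigma> 1)"
    "\<not> (\<sigma> (\<sigma> 3) < \<sigma> (\<sigma> 2) \<and> \<sigma> (\<sigma> 2) < \<sigma> (\<sigma> 1))"
  shows "\<sigma> \<in> SAv b {[3,2,1], [3,4,1,2]}"
proof -
  have *: "i = 1 \<and> j = 2 \<and> k = 3" if "1 \<le> i \<and> i < j \<and> j < k \<and> k \<le> b" for i j k :: nat
    using that assms(2) by linarith
  have "avoids_both b f" if "\<not> (f 3 < f 2 \<and> f 2 < f 1)" for f
    unfolding avoids_both_def
  proof (intro conjI allI impI)
    show "\<not> (f k < f j \<and> f j < f i)" if "1 \<le> i \<and> i < j \<and> j < k \<and> k \<le> b" for i j k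
      using *[OF that] \<open>\<not> (f 3 < f 2 \<and> f 2 < f 1)\<close> by simp
    show "\<not> (f k < f l \<and> f l < f i \<and> f i < f j)"
      if "1 \<le> i \<and> i < j \<and> j < k \<and> k < l \<and> l \<le> b" for i j k l
      using that assms(2) by linarith
  qed
  from this[of \<sigma>] this[of "\<sigma> \<circ> \<sigma>"] show ?thesis using assms by (simp add: mem_SAv_iff)
qed

lemma finite_SAv: "finite (SAv n T)"
  by (rule finite_subset[OF _ finite_permutations[of "{1..n}"]]) (auto simp: SAv_def)

lemma block_permutes:
  "id permutes {1..1 :: nat}"
  "id(1 := 2, 2 := 1) permutes {1..2 :: nat}"
  "id(1 := 2, 2 := 3, 3 := 1) permutes {1..3 :: nat}"
  "id(1 := 3, 2 := 1, 3 := 2) permutes {1..3 :: nat}"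
  by (rule inj_imp_permutes; force simp: inj_on_def)+

text \<open>The factor 2 accounts for the blocks 231 and 312. The guards matter because truncated
  subtraction would otherwise count the empty permutation, for instance through \<open>n - 2\<close>
  at \<open>n = 1\<close>.\<close>

lemma card_SAv_rec:
  assumes n: "1 \<le> n"
  shows "card (SAv n {[3,2,1], [3,4,1,2]}) =
    card (SAv (n - 1) {[3,2,1], [3,4,1,2]}) +
    (if n \<ge> 2 then card (SAv (n - 2) {[3,2,1], [3,4,1,2]}) else 0) +
    (if n \<ge> 3 then 2 * card (SAv (n - 3) {[3,2,1], [3,4,1,2]}) else 0)"
proof -
  let ?S = "\<lambda>n. SAv n {[3,2,1], [3,4,1,2]}"
  define B where "B b \<sigma> = {\<pi> \<in> ?S n. \<forall>i\<in>{1..b}. \<pi> i = \<sigma> i}" for b and \<sigma> :: "nat \<Rightarrow> nat"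
  define B1 where "B1 = B 1 id"
  define B2 where "B2 = (if n \<ge> 2 then B 2 (id(1 := 2, 2 := 1)) else {})"
  define B3 where "B3 = (if n \<ge> 3 then B 3 (id(1 := 2, 2 := 3, 3 := 1)) else {})"
  define B4 where "B4 = (if n \<ge> 3 then B 3 (id(1 := 3, 2 := 1, 3 := 2)) else {})"
  note defs = B1_def B2_def B3_def B4_def
  have cardB: "card (B b \<sigma>) = card (?S (n - b))" if "\<sigma> \<in> ?S b" "b \<le> n" for b \<sigma>
    using card_SAv_first_block[OF that(1), of "n - b"] that(2) by (simp add: B_def)
  have c1: "card B1 = card (?S (n - 1))"
    unfolding B1_def by (rule cardB[OF mem_SAv_small]) (use n block_permutes in auto)
  have c2: "card B2 = (if n \<ge> 2 then card (?S (n - 2)) else 0)"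
    unfolding B2_def using cardB[OF mem_SAv_small, OF block_permutes(2)] by simp
  have c3: "card B3 = (if n \<ge> 3 then card (?S (n - 3)) else 0)"
    unfolding B3_def using cardB[OF mem_SAv_small, OF block_permutes(3)] by simp
  have c4: "card B4 = (if n \<ge> 3 then card (?S (n - 3)) else 0)"
    unfolding B4_def using cardB[OF mem_SAv_small, OF block_permutes(4)] by simp
  have iv: "{1..2 :: nat} = {1, 2}" "{1..3 :: nat} = {1, 2, 3}" by auto
  have "?S n = B1 \<union> (B2 \<union> (B3 \<union> B4))"
  proof
    show "B1 \<union> (B2 \<union> (B3 \<union> B4)) \<subseteq> ?S n" by (auto simp: defs B_def)
    show "?S n \<subseteq> B1 \<union> (B2 \<union> (B3 \<union> B4))"
    proof
      fix \<pi> assume h: "\<pi> \<in> ?S n"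
      then have p: "\<pi> permutes {1..n}" by (simp add: mem_SAv_iff)
      \<comment> \<open>These bounds exclude the blocks that are longer than
        \<open>n\<close>.\<close>
      have le: "\<pi> 1 \<le> n" "n \<ge> 2 \<Longrightarrow> \<pi> 2 \<le> n"
        using permutes_in_image[OF p, of 1] permutes_in_image[OF p, of 2] n by auto
      show "\<pi> \<in> B1 \<union> (B2 \<union> (B3 \<union> B4))"
        using first_block_cases[OF h n] h le by (auto simp: defs B_def iv)
    qed
  qed
  moreover have "B1 \<inter> (B2 \<union> (B3 \<union> B4)) = {}" "B2 \<inter> (B3 \<union> B4) = {}" "B3 \<inter> B4 = {}"
    by (auto simp: defs B_def iv)
  moreover have "finite B1" "finite B2" "finite B3" "finite B4"
    using finite_SAv by (auto simp: defs B_def)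
  ultimately have "card (?S n) = card B1 + (card B2 + (card B3 + card B4))"
    by (simp add: card_Un_disjoint)
  then show ?thesis unfolding c1 c2 c3 c4 by simp
qed

section \<open>The generating function\<close>

lemma card_SAv_0: "card (SAv 0 {[3,2,1], [3,4,1,2]}) = 1"
proof -
  have "SAv 0 {[3,2,1], [3,4,1,2]} = {id}"
    by (auto simp: mem_SAv_iff avoids_both_def)
  then show ?thesis by simp
qed

theorem theorem1p4:
  shows "1 + Abs_fps (\<lambda>n. if n \<ge> 1 then of_nat (card (SAv n {[3,2,1], [3,4,1,2]})) else 0)
         = (1 / (1 - fps_X - fps_X ^ 2 - 2 * fps_X ^ 3) :: rat fps)"
proof -
  let ?a = "\<lambda>n. of_nat (card (SAv n {[3,2,1], [3,4,1,2]})) :: rat"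
  let ?q = "1 - fps_X - fps_X ^ 2 - 2 * fps_X ^ 3 :: rat fps"
  \<comment> \<open>The separate constant 1 is the coefficient at \<open>n = 0\<close>, so
    \<open>F\<close> is the whole left-hand side.\<close>
  define F where "F = Abs_fps ?a"
  have F: "1 + Abs_fps (\<lambda>n. if n \<ge> 1 then ?a n else 0) = F"
    by (rule fps_ext) (auto simp: F_def card_SAv_0 not_le)
  define G where "G = fps_X * F + fps_X ^ 2 * F + 2 * (fps_X ^ 3 * F)"
  have FG: "F = 1 + G"
  proof (rule fps_ext)
    fix n
    have two: "fps_nth (2 * G) n = 2 * fps_nth G n" for G :: "rat fps"
      by (simp only: mult_2 fps_add_nth)
    \<comment> \<open>This is the recurrence coefficientwise: multiplying by a power of
      \<open>fps_X\<close> shifts the index and gives 0 below the exponent, matching the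
      guards.\<close>
    show "fps_nth F n = fps_nth (1 + G) n"
      using card_SAv_rec[of n]
      by (cases "n = 0")
        (auto simp: G_def F_def card_SAv_0 two fps_X_power_mult_nth)
  qed
  have "?q * F = F - G" by (simp add: G_def algebra_simps)
  also have "\<dots> = 1" by (simp add: FG)
  finally have "inverse ?q = F" by (rule fps_inverse_unique)
  then have "1 / ?q = F" by (simp add: fps_divide_unit)
  then show ?thesis using F by simp
qed

end
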